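(* Let $\{A,B\}$ be a dual pair of densely defined closed operators in a Hilbert space $\mathfrak{H}$. Then the following orthogonal decompositions hold: $$\mathrm{dom}\,A^*=\mathrm{dom}\,B\oplus_A\ker(I+B^*A^* ),\qquad \mathrm{dom}\,B^*=\mathrm{dom}\,A\oplus_B\ker(I+A^*B^* ).$$ In particular, $A^*=B$ (or, equivalently, $A=B^*$) if and only if $\ker(I+B^*A^* )=\{0\}$ (or, equivalently, $\ker(I+A^*B^* )=\{0\}$).
   Context: Operators $A,B$ in $\mathfrak{H}$ form a dual pair $\{A,B\}$ if $(Af,g)=(f,Bg)$ for all $f\in\mathrm{dom}\,A$, $g\in\mathrm{dom}\,B$ (for densely defined closable operators: $A\subseteq B^*$ and $B\subseteq A^*$). For a closable densely defined operator $A$, $\mathfrak{H}_{+A}$ is the Hilbert space $\mathrm{dom}\,A^*$ with inner product $(f,g)_{+A}=(f,g)+(A^*f,A^*g)$, and $\oplus_A$ denotes the orthogonal sum in $\mathfrak{H}_{+A}$; similarly $\oplus_B$ is the orthogonal sum in $\mathfrak{H}_{+B}=\mathrm{dom}\,B^*$ with inner product $(f,g)+(B^*f,B^*g)$. *)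

theory Defs
  imports "HOL-Analysis.Analysis"
begin

section \<open>Complex Hilbert spaces\<close>

class scaleC =
  fixes scaleC :: "complex \<Rightarrow> 'a \<Rightarrow> 'a"  (infixr "*\<^sub>C" 75)

class complex_vector = real_vector + scaleC +
  assumes scaleC_add_right: "a *\<^sub>C (x + y) = a *\<^sub>C x + a *\<^sub>C y"
    and scaleC_add_left: "(a + b) *\<^sub>C x = a *\<^sub>C x + b *\<^sub>C x"
    and scaleC_scaleC: "a *\<^sub>C (b *\<^sub>C x) = (a * b) *\<^sub>C x"
    and scaleC_one: "1 *\<^sub>C x = x"
    and scaleR_scaleC: "r *\<^sub>R x = complex_of_real r *\<^sub>C x"

text \<open>The inner product is linear in the first argument. Extending \<open>real_normed_vector\<close> is no
  restriction: its triangle inequality and homogeneity of the norm follow from the axioms below, the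
  rest of it only says that metric and topology are those of the norm.\<close>

class complex_inner = complex_vector + real_normed_vector +
  fixes cinner :: "'a \<Rightarrow> 'a \<Rightarrow> complex"
  assumes cinner_commute: "cinner x y = cnj (cinner y x)"
    and cinner_add_left: "cinner (x + y) z = cinner x z + cinner y z"
    and cinner_scaleC_left: "cinner (a *\<^sub>C x) y = a * cinner x y"
    and cinner_ge_zero: "0 \<le> Re (cinner x x)"
    and cinner_eq_zero_iff: "cinner x x = 0 \<longleftrightarrow> x = 0"
    and norm_eq_sqrt_cinner: "norm x = sqrt (Re (cinner x x))"

class chilbert_space = complex_inner + complete_space

global_interpretation complex_vector:
  vector_space "scaleC :: complex \<Rightarrow> 'a \<Rightarrow> 'a::complex_vector"
  by unfold_locales
    (simp_all add: scaleC_add_right scaleC_add_left scaleC_scaleC scaleC_one)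

instantiation complex :: chilbert_space
begin

definition scaleC_complex_def: "a *\<^sub>C x = a * (x::complex)"
definition cinner_complex_def: "cinner x y = x * cnj (y::complex)"

instance
  by standard
    (simp_all add: scaleC_complex_def cinner_complex_def algebra_simps scaleR_conv_of_real
      cmod_def power2_eq_square)

end


section \<open>Unbounded operators\<close>

text \<open>An operator \<open>A\<close> in \<open>\<HH>\<close> is a partial function with domain \<open>dom A\<close>, and \<open>the (A f)\<close>
  is its value at \<open>f \<in> dom A\<close>. Thus \<open>=\<close> is equality of operators including their domains,
  \<open>Some\<close> is the identity operator, and \<open>S \<circ>\<^sub>m T\<close> is the product \<open>S T\<close> on its natural domain
  \<open>{f \<in> dom T. T f \<in> dom S}\<close>.\<close>

definition linear_operator :: "('a::complex_vector \<rightharpoonup> 'a) \<Rightarrow> bool" where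
  "linear_operator A \<longleftrightarrow>
     complex_vector.subspace (dom A) \<and>
     (\<forall>f\<in>dom A. \<forall>g\<in>dom A. the (A (f + g)) = the (A f) + the (A g)) \<and>
     (\<forall>c. \<forall>f\<in>dom A. the (A (c *\<^sub>C f)) = c *\<^sub>C the (A f))"

definition densely_defined :: "('a::topological_space \<rightharpoonup> 'a) \<Rightarrow> bool" where
  "densely_defined A \<longleftrightarrow> closure (dom A) = UNIV"

definition closed_operator :: "('a::topological_space \<rightharpoonup> 'a) \<Rightarrow> bool" where
  "closed_operator A \<longleftrightarrow> closed (Map.graph A)"

definition op_add :: "('a::plus \<rightharpoonup> 'a) \<Rightarrow> ('a \<rightharpoonup> 'a) \<Rightarrow> ('a \<rightharpoonup> 'a)" where
  "op_add S T = (\<lambda>f. if f \<in> dom S \<inter> dom T then Some (the (S f) + the (T f)) else None)"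

definition op_ker :: "('a::zero \<rightharpoonup> 'a) \<Rightarrow> 'a set" where
  "op_ker T = {f \<in> dom T. the (T f) = 0}"

text \<open>Meaningful for densely defined \<open>A\<close> only, where \<open>h\<close> is uniquely determined by \<open>g\<close>.\<close>

definition adj :: "('a::complex_inner \<rightharpoonup> 'a) \<Rightarrow> ('a \<rightharpoonup> 'a)" where
  "adj A = (\<lambda>g. if \<exists>h. \<forall>f\<in>dom A. cinner (the (A f)) g = cinner f h
                then Some (THE h. \<forall>f\<in>dom A. cinner (the (A f)) g = cinner f h)
                else None)"

definition dual_pair :: "('a::complex_inner \<rightharpoonup> 'a) \<Rightarrow> ('a \<rightharpoonup> 'a) \<Rightarrow> bool" where
  "dual_pair A B \<longleftrightarrow>
     (\<forall>f\<in>dom A. \<forall>g\<in>dom B. cinner (the (A f)) g = cinner f (the (B g)))"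


section \<open>The Hilbert space \<open>\<HH>\<^sub>+\<^sub>A\<close> on the domain of the adjoint\<close>

definition plus_inner :: "('a::complex_inner \<rightharpoonup> 'a) \<Rightarrow> 'a \<Rightarrow> 'a \<Rightarrow> complex" where
  "plus_inner A f g = cinner f g + cinner (the (adj A f)) (the (adj A g))"

definition plus_norm :: "('a::complex_inner \<rightharpoonup> 'a) \<Rightarrow> 'a \<Rightarrow> real" where
  "plus_norm A f = sqrt (Re (plus_inner A f f))"

definition plus_closed_subspace :: "('a::complex_inner \<rightharpoonup> 'a) \<Rightarrow> 'a set \<Rightarrow> bool" where
  "plus_closed_subspace A M \<longleftrightarrow>
     M \<subseteq> dom (adj A) \<and> complex_vector.subspace M \<and>
     (\<forall>X. \<forall>f\<in>dom (adj A). (\<forall>n. X n \<in> M) \<longrightarrow>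
        (\<lambda>n. plus_norm A (X n - f)) \<longlonglongrightarrow> 0 \<longrightarrow> f \<in> M)"

text \<open>\<open>is_orth_sum A L M N\<close> reads \<open>L = M \<oplus>\<^sub>A N\<close>; as usual the summands of an orthogonal sum
  are closed subspaces of \<open>\<HH>\<^sub>+\<^sub>A\<close>.\<close>

definition is_orth_sum ::
    "('a::complex_inner \<rightharpoonup> 'a) \<Rightarrow> 'a set \<Rightarrow> 'a set \<Rightarrow> 'a set \<Rightarrow> bool" where
  "is_orth_sum A L M N \<longleftrightarrow>
     plus_closed_subspace A M \<and> plus_closed_subspace A N \<and>
     (\<forall>f\<in>M. \<forall>g\<in>N. plus_inner A f g = 0) \<and>
     L = {f + g | f g. f \<in> M \<and> g \<in> N}"

end

theory Submission
  imports Defs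
begin

text \<open>
  A dual pair satisfies \<open>B \<subseteq> A\<^sup>*\<close>, so the map \<open>f \<mapsto> (f, A\<^sup>* f)\<close> identifies \<open>\<HH>\<^sub>+\<^sub>A\<close> isometrically
  with the graph of \<open>A\<^sup>*\<close> inside \<open>\<HH> \<times> \<HH>\<close>, and \<open>dom B\<close> with the graph of \<open>B\<close>, which is a closed
  subspace of \<open>\<HH> \<times> \<HH>\<close>. The orthogonal complement of \<open>dom B\<close> in \<open>\<HH>\<^sub>+\<^sub>A\<close> is the set of all
  \<open>g \<in> dom A\<^sup>*\<close> with \<open>(B u, A\<^sup>* g) = (u, - g)\<close> for every \<open>u \<in> dom B\<close>; by the definition of \<open>B\<^sup>*\<close> this
  says \<open>B\<^sup>* A\<^sup>* g = - g\<close>, so the complement is \<open>ker (I + B\<^sup>* A\<^sup>*)\<close> (lemma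
  \<open>kernel_eq_plus_complement\<close>). The decomposition of \<open>dom A\<^sup>*\<close> is therefore the projection theorem in
  \<open>\<HH> \<times> \<HH>\<close>, applied to a point \<open>(f, A\<^sup>* f)\<close> and the graph of \<open>B\<close>; as the projection lies in that graph,
  the remainder still lies in the graph of \<open>A\<^sup>*\<close> (lemma \<open>dom_adj_decomposition\<close>). The
  decomposition of \<open>dom B\<^sup>*\<close> is the same statement for the dual pair \<open>{B, A}\<close>.

  The decomposition shows that \<open>A\<^sup>* = B\<close> exactly when the kernel is trivial. Finally, if
  \<open>B\<^sup>* A\<^sup>* f = - f\<close>, then \<open>g = A\<^sup>* f\<close> satisfies \<open>A\<^sup>* B\<^sup>* g = - g\<close>, and \<open>g = 0\<close> forces \<open>f = 0\<close>.
  Hence the two kernels vanish simultaneously, and the criterion applied to \<open>{A, B}\<close> and to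
  \<open>{B, A}\<close> shows that \<open>A\<^sup>* = B\<close> and \<open>A = B\<^sup>*\<close> are equivalent.
\<close>

section \<open>Complex inner product spaces\<close>

lemma cinner_add_right: "cinner x (y + z) = cinner x y + cinner x (z::'a::complex_inner)"
  by (metis cinner_add_left cinner_commute complex_cnj_add)

lemma cinner_scaleC_right: "cinner x (a *\<^sub>C y) = cnj a * cinner x (y::'a::complex_inner)"
  by (metis cinner_commute cinner_scaleC_left complex_cnj_mult)

lemma scaleC_minus_one: "(-1) *\<^sub>C x = - (x::'a::complex_vector)"
  using scaleR_scaleC[of "-1" x] by simp

lemma cinner_minus_left: "cinner (- x) y = - cinner x (y::'a::complex_inner)"
  by (metis cinner_scaleC_left mult_minus1 scaleC_minus_one)

lemma cinner_minus_right: "cinner x (- y) = - cinner x (y::'a::complex_inner)"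
  by (metis cinner_commute cinner_minus_left complex_cnj_minus)

lemma cinner_diff_left: "cinner (x - y) z = cinner x z - cinner y (z::'a::complex_inner)"
  by (metis cinner_add_left cinner_minus_left diff_conv_add_uminus)

lemma cinner_diff_right: "cinner x (y - z) = cinner x y - cinner x (z::'a::complex_inner)"
  by (metis cinner_add_right cinner_minus_right diff_conv_add_uminus)

lemma cinner_zero_right: "cinner x 0 = (0::complex)" for x :: "'a::complex_inner"
  using cinner_diff_right[of x 0 0] by simp

lemma cinner_self: "cinner x x = complex_of_real ((norm x)\<^sup>2)" for x :: "'a::complex_inner"
proof -
  have "Im (cinner x x) = 0"
    using arg_cong[OF cinner_commute[of x x], of Im] by simp
  then show ?thesis
    by (simp add: complex_eq_iff norm_eq_sqrt_cinner cinner_ge_zero)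
qed

lemma norm_diff_square:
  "(norm (x - y))\<^sup>2 = (norm x)\<^sup>2 - 2 * Re (cinner x y) + (norm y)\<^sup>2" for x :: "'a::complex_inner"
proof -
  have "complex_of_real ((norm (x - y))\<^sup>2) =
      cinner x x - (cinner x y + cinner y x) + cinner y y"
    unfolding cinner_self[symmetric] by (simp add: cinner_diff_left cinner_diff_right)
  then have "Re (complex_of_real ((norm (x - y))\<^sup>2)) =
      Re (cinner x x - (cinner x y + cinner y x) + cinner y y)"
    by simp
  moreover have "Re (cinner y x) = Re (cinner x y)"
    using arg_cong[OF cinner_commute[of y x], of Re] by simp
  ultimately show ?thesis
    by (simp add: cinner_self)
qed

lemma parallelogram_law:
  "(norm (x - y))\<^sup>2 + (norm (x + y))\<^sup>2 = 2 * (norm x)\<^sup>2 + 2 * (norm y)\<^sup>2" for x :: "'a::complex_inner"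
  using norm_diff_square[of x y] norm_diff_square[of x "- y"] by (simp add: cinner_minus_right)

text \<open>Subtracting from \<open>x\<close> its component along \<open>y\<close> lowers the norm by a computable amount. That the
  left side is nonnegative is the Cauchy--Schwarz inequality; that it cannot be smaller than
  \<open>(norm x)\<^sup>2\<close> when \<open>x\<close> has minimal norm makes minimizers orthogonal.\<close>

lemma norm_diff_component_square:
  fixes x y :: "'a::complex_inner"
  assumes "y \<noteq> 0"
  shows "(norm (x - (cinner x y / (norm y)\<^sup>2) *\<^sub>C y))\<^sup>2 = (norm x)\<^sup>2 - (cmod (cinner x y) / norm y)\<^sup>2"
proof -
  define c where "c = cinner x y / (norm y)\<^sup>2"
  have norm_pos: "norm y > 0"
    using assms by simp
  have "cinner x (c *\<^sub>C y) = (cnj (cinner x y) * cinner x y) / (norm y)\<^sup>2"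
    by (simp add: cinner_scaleC_right c_def)
  also have "cnj (cinner x y) * cinner x y = (cmod (cinner x y))\<^sup>2"
    by (metis complex_norm_square mult.commute of_real_power)
  finally have mixed: "cinner x (c *\<^sub>C y) = complex_of_real ((cmod (cinner x y) / norm y)\<^sup>2)"
    by (simp add: power_divide)
  have "cinner (c *\<^sub>C y) (c *\<^sub>C y) = (c * cnj c) * cinner y y"
    by (simp add: cinner_scaleC_left cinner_scaleC_right)
  also have "\<dots> = complex_of_real ((cmod c)\<^sup>2 * (norm y)\<^sup>2)"
    by (simp add: cinner_self flip: complex_norm_square)
  also have "(cmod c)\<^sup>2 * (norm y)\<^sup>2 = (cmod (cinner x y) / norm y)\<^sup>2"
    using norm_pos by (simp add: c_def norm_divide norm_mult power_divide field_simps power2_eq_square)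
  finally have "(norm (c *\<^sub>C y))\<^sup>2 = (cmod (cinner x y) / norm y)\<^sup>2"
    unfolding cinner_self of_real_eq_iff .
  then show ?thesis
    using mixed norm_diff_square[of x "c *\<^sub>C y"] unfolding c_def[symmetric] by simp
qed

lemma cauchy_schwarz: "cmod (cinner x y) \<le> norm x * norm y" for x y :: "'a::complex_inner"
proof (cases "y = 0")
  case True
  then show ?thesis
    by (simp add: cinner_zero_right)
next
  case False
  then have "(cmod (cinner x y) / norm y)\<^sup>2 \<le> (norm x)\<^sup>2"
    using norm_diff_component_square[of y x]
      zero_le_power2[of "norm (x - (cinner x y / (norm y)\<^sup>2) *\<^sub>C y)"] by linarith
  then have "cmod (cinner x y) / norm y \<le> norm x"
    by (rule power2_le_imp_le) simp
  with False show ?thesis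
    by (simp add: field_simps)
qed

lemma tendsto_cinner_right:
  fixes u :: "'a::complex_inner"
  assumes "X \<longlonglongrightarrow> x"
  shows "(\<lambda>n. cinner u (X n)) \<longlonglongrightarrow> cinner u x"
proof (rule LIM_zero_cancel)
  have "(\<lambda>n. norm (X n - x)) \<longlonglongrightarrow> 0"
    using assms by (simp add: tendsto_norm_zero_iff LIM_zero_iff)
  then have "(\<lambda>n. norm u * norm (X n - x)) \<longlonglongrightarrow> 0"
    by (rule tendsto_mult_right_zero)
  then show "(\<lambda>n. cinner u (X n) - cinner u x) \<longlonglongrightarrow> 0"
    by (rule Lim_null_comparison[rotated])
      (simp add: cauchy_schwarz flip: cinner_diff_right)
qed

lemma eq_zero_if_orthogonal_to_dense:
  fixes h :: "'a::complex_inner"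
  assumes "closure D = UNIV" and orth: "\<And>f. f \<in> D \<Longrightarrow> cinner f h = 0"
  shows "h = 0"
proof -
  obtain X where X: "\<And>n. X n \<in> D" "X \<longlonglongrightarrow> h"
    using assms(1) closure_sequential[of h D] by auto
  have "(\<lambda>n. cinner h (X n)) = (\<lambda>n. 0)"
    using X(1) orth by (metis cinner_commute complex_cnj_zero)
  then have "cinner h h = 0"
    using tendsto_cinner_right[OF X(2), of h] by (simp add: LIMSEQ_const_iff)
  then show ?thesis
    by (simp add: cinner_eq_zero_iff)
qed

section \<open>The Hilbert space of pairs\<close>

instantiation prod :: (complex_vector, complex_vector) complex_vector
begin

definition scaleC_prod_def: "a *\<^sub>C x = (a *\<^sub>C fst x, a *\<^sub>C snd x)"

instance
  by standard
    (simp_all add: scaleC_prod_def scaleC_add_right scaleC_add_left scaleC_scaleC scaleC_one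
      scaleR_scaleC prod_eq_iff)

end

text \<open>The norm of a pair is already the Euclidean combination of the norms of its components, so it is
  the norm of the sum of the two inner products.\<close>

instantiation prod :: (complex_inner, complex_inner) complex_inner
begin

definition cinner_prod_def: "cinner x y = cinner (fst x) (fst y) + cinner (snd x) (snd y)"

instance
proof
  fix x y z :: "'a \<times> 'b" and a :: complex
  show "cinner x y = cnj (cinner y x)"
    unfolding cinner_prod_def by (metis cinner_commute complex_cnj_add)
  show "cinner (x + y) z = cinner x z + cinner y z"
    by (simp add: cinner_prod_def cinner_add_left)
  show "cinner (a *\<^sub>C x) y = a * cinner x y"
    by (simp add: cinner_prod_def scaleC_prod_def cinner_scaleC_left algebra_simps)
  have self: "cinner x x = complex_of_real ((norm (fst x))\<^sup>2 + (norm (snd x))\<^sup>2)"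
    by (simp add: cinner_prod_def cinner_self)
  show "0 \<le> Re (cinner x x)"
    by (simp add: self del: of_real_add)
  show "cinner x x = 0 \<longleftrightarrow> x = 0"
    unfolding self of_real_eq_0_iff by (simp add: sum_power2_eq_zero_iff prod_eq_iff)
  show "norm x = sqrt (Re (cinner x x))"
    by (simp add: self norm_prod_def del: of_real_add)
qed

end

instance prod :: (chilbert_space, chilbert_space) chilbert_space ..

section \<open>Orthogonal projection onto a closed subspace\<close>

text \<open>The usual argument: by the parallelogram law, two points of the subspace that are both nearly
  closest to \<open>x\<close> are close to each other, since their midpoint is not closer than the distance. So a
  minimizing sequence converges.\<close>

lemma exists_closest_point:
  fixes M :: "'a::chilbert_space set"
  assumes closed: "closed M" and subspace: "complex_vector.subspace M"
  obtains y where "y \<in> M" and "\<And>z. z \<in> M \<Longrightarrow> norm (x - y) \<le> norm (x - z)"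
proof -
  define d where "d = (INF z\<in>M. norm (x - z))"
  have nonempty: "M \<noteq> {}"
    using complex_vector.subspace_0[OF subspace] by blast
  have bdd: "bdd_below ((\<lambda>z. norm (x - z)) ` M)"
    by (rule bdd_belowI2[of _ 0]) simp
  have d_le: "d \<le> norm (x - z)" if "z \<in> M" for z
    unfolding d_def by (rule cINF_lower[OF bdd that])
  have d_nonneg: "0 \<le> d"
    unfolding d_def by (rule cINF_greatest[OF nonempty]) simp
  have "\<exists>z\<in>M. (norm (x - z))\<^sup>2 < d\<^sup>2 + inverse (Suc n)" for n
  proof -
    have "d < sqrt (d\<^sup>2 + inverse (Suc n))"
      by (rule real_less_rsqrt) simp
    then obtain z where "z \<in> M" "norm (x - z) < sqrt (d\<^sup>2 + inverse (Suc n))"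
      using cINF_less_iff[OF nonempty bdd] unfolding d_def by blast
    then show ?thesis
      using real_le_rsqrt[of "norm (x - z)"] d_nonneg
      by (metis abs_norm_cancel not_less real_sqrt_abs real_sqrt_le_mono)
  qed
  then obtain Y where Y: "\<And>n. Y n \<in> M"
    and near: "\<And>n. (norm (x - Y n))\<^sup>2 < d\<^sup>2 + inverse (Suc n)"
    by metis
  have dist_le: "(norm (Y m - Y n))\<^sup>2 < 2 * inverse (Suc m) + 2 * inverse (Suc n)" for m n
  proof -
    define mid where "mid = (1/2) *\<^sub>R (Y m + Y n)"
    have "mid \<in> M"
      unfolding mid_def scaleR_scaleC
      by (intro complex_vector.subspace_scale complex_vector.subspace_add subspace Y)
    then have "d\<^sup>2 \<le> (norm (x - mid))\<^sup>2"
      using d_le d_nonneg by (simp add: power_mono)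
    moreover have "(x - Y n) + (x - Y m) = 2 *\<^sub>R (x - mid)"
      by (simp add: mid_def algebra_simps scaleR_2)
    ultimately have "4 * d\<^sup>2 \<le> (norm ((x - Y n) + (x - Y m)))\<^sup>2"
      by (simp add: power_mult_distrib)
    moreover have "(x - Y n) - (x - Y m) = Y m - Y n"
      by simp
    ultimately show ?thesis
      using parallelogram_law[of "x - Y n" "x - Y m"] near[of m] near[of n] by simp
  qed
  have "Cauchy Y"
  proof (rule CauchyI)
    fix e :: real
    assume "0 < e"
    then obtain k where k: "inverse (Suc k) < e\<^sup>2 / 4"
      using reals_Archimedean[of "e\<^sup>2 / 4"] by auto
    have "norm (Y m - Y n) < e" if "k \<le> m" "k \<le> n" for m n
    proof -
      have "inverse (real (Suc m)) \<le> inverse (Suc k)" "inverse (real (Suc n)) \<le> inverse (Suc k)"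
        using that by (simp_all add: le_imp_inverse_le)
      then have "(norm (Y m - Y n))\<^sup>2 < e\<^sup>2"
        using dist_le[of m n] k by linarith
      then show ?thesis
        using \<open>0 < e\<close> by (simp add: power2_less_imp_less)
    qed
    then show "\<exists>N. \<forall>m\<ge>N. \<forall>n\<ge>N. norm (Y m - Y n) < e"
      by blast
  qed
  then obtain y where lim: "Y \<longlonglongrightarrow> y"
    using Cauchy_convergent convergent_def by blast
  have "y \<in> M"
    using closed_sequentially[OF closed] Y lim by blast
  have "(\<lambda>n. d\<^sup>2 + inverse (real (Suc n))) \<longlonglongrightarrow> d\<^sup>2 + 0"
    by (intro tendsto_intros LIMSEQ_inverse_real_of_nat)
  moreover have "(\<lambda>n. (norm (x - Y n))\<^sup>2) \<longlonglongrightarrow> (norm (x - y))\<^sup>2"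
    by (intro tendsto_intros lim)
  ultimately have "(norm (x - y))\<^sup>2 \<le> d\<^sup>2"
    using near by (intro LIMSEQ_le[of _ _ "\<lambda>n. d\<^sup>2 + inverse (real (Suc n))"])
      (auto intro: less_imp_le)
  then have "norm (x - y) \<le> d"
    using d_nonneg by (rule power2_le_imp_le)
  with that[OF \<open>y \<in> M\<close>] d_le show thesis
    by (meson order_trans)
qed

lemma exists_orthogonal_projection:
  fixes M :: "'a::chilbert_space set"
  assumes "closed M" and subspace: "complex_vector.subspace M"
  obtains y where "y \<in> M" and "\<And>z. z \<in> M \<Longrightarrow> cinner z (x - y) = 0"
proof -
  obtain y where y: "y \<in> M" and closest: "\<And>z. z \<in> M \<Longrightarrow> norm (x - y) \<le> norm (x - z)"
    using exists_closest_point[OF assms] by blast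
  have "cinner z (x - y) = 0" if "z \<in> M" for z
  proof (cases "z = 0")
    case True
    then show ?thesis
      by (metis cinner_commute cinner_zero_right complex_cnj_zero)
  next
    case False
    define c where "c = cinner (x - y) z / (norm z)\<^sup>2"
    \<comment> \<open>Moving \<open>y\<close> by the component of \<open>x - y\<close> along \<open>z\<close> would give a closer point, unless that
      component vanishes.\<close>
    have "y + c *\<^sub>C z \<in> M"
      by (intro complex_vector.subspace_scale complex_vector.subspace_add subspace y that)
    from closest[OF this] have "(norm (x - y))\<^sup>2 \<le> (norm (x - y - c *\<^sub>C z))\<^sup>2"
      by (simp add: power_mono diff_diff_eq)
    then have "(cmod (cinner (x - y) z) / norm z)\<^sup>2 \<le> 0"
      unfolding c_def norm_diff_component_square[OF False] by simp
    then have "cinner (x - y) z = 0"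
      using False by simp
    then show ?thesis
      by (metis cinner_commute complex_cnj_zero)
  qed
  with y that show thesis
    by blast
qed

section \<open>Adjoints and dual pairs\<close>

text \<open>Density of the domain makes the vector \<open>h\<close> in the definition of the adjoint unique, so the
  description operator there picks exactly this vector.\<close>

lemma adj_eq_Some_iff:
  fixes A :: "'a::complex_inner \<rightharpoonup> 'a"
  assumes "densely_defined A"
  shows "adj A g = Some h \<longleftrightarrow> (\<forall>f\<in>dom A. cinner (the (A f)) g = cinner f h)" (is "_ \<longleftrightarrow> ?adjoint h")
proof -
  have unique: "h' = h''" if "?adjoint h'" "?adjoint h''" for h' h''
  proof -
    have "cinner f (h' - h'') = 0" if "f \<in> dom A" for f
      using \<open>?adjoint h'\<close> \<open>?adjoint h''\<close> that by (simp add: cinner_diff_right)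
    then have "h' - h'' = 0"
      using assms eq_zero_if_orthogonal_to_dense unfolding densely_defined_def by blast
    then show ?thesis
      by simp
  qed
  have the_adjoint: "(THE h. ?adjoint h) = h'" if "?adjoint h'" for h'
    using that unique by (intro the_equality) blast+
  show ?thesis
  proof
    assume "adj A g = Some h"
    then have "\<exists>h'. ?adjoint h'" "(THE h. ?adjoint h) = h"
      unfolding adj_def by (auto split: if_splits)
    then show "?adjoint h"
      using the_adjoint by blast
  next
    assume "?adjoint h"
    then show "adj A g = Some h"
      using the_adjoint unfolding adj_def by auto
  qed
qed

lemma linear_operator_adj:
  fixes A :: "'a::complex_inner \<rightharpoonup> 'a"
  assumes dense: "densely_defined A"
  shows "linear_operator (adj A)"
proof -
  note iff = adj_eq_Some_iff[OF dense]
  have zero: "adj A 0 = Some 0"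
    by (simp add: iff cinner_zero_right)
  have add: "adj A (f + g) = Some (h + k)" if "adj A f = Some h" "adj A g = Some k" for f g h k
    using that by (simp add: iff cinner_add_right)
  have scale: "adj A (c *\<^sub>C f) = Some (c *\<^sub>C h)" if "adj A f = Some h" for c f h
    using that by (simp add: iff cinner_scaleC_right)
  show ?thesis
    unfolding linear_operator_def
  proof (intro conjI ballI allI)
    show "complex_vector.subspace (dom (adj A))"
      by (rule complex_vector.subspaceI) (use zero add scale in \<open>blast+\<close>)
    show "the (adj A (f + g)) = the (adj A f) + the (adj A g)"
      if "f \<in> dom (adj A)" "g \<in> dom (adj A)" for f g
      using that add by fastforce
    show "the (adj A (c *\<^sub>C f)) = c *\<^sub>C the (adj A f)" if "f \<in> dom (adj A)" for c f
      using that scale by fastforce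
  qed
qed

lemma linear_operator_diff:
  fixes T :: "'a::complex_vector \<rightharpoonup> 'a"
  assumes "linear_operator T" and "f \<in> dom T" and "g \<in> dom T"
  shows "f - g \<in> dom T" and "the (T (f - g)) = the (T f) - the (T g)"
proof -
  have "the (T ((-1) *\<^sub>C g)) = (-1) *\<^sub>C the (T g)"
    using assms(1,3) unfolding linear_operator_def by blast
  then have g': "the (T (- g)) = - the (T g)"
    by (simp only: scaleC_minus_one)
  have g: "- g \<in> dom T"
    using assms(1,3) by (simp add: linear_operator_def complex_vector.subspace_neg)
  show "f - g \<in> dom T"
    using assms by (simp add: linear_operator_def complex_vector.subspace_diff)
  have "the (T (f + - g)) = the (T f) + the (T (- g))"
    using assms(1,2) g unfolding linear_operator_def by blast
  then show "the (T (f - g)) = the (T f) - the (T g)"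
    using g' by simp
qed

lemma mem_graph_iff: "p \<in> Map.graph T \<longleftrightarrow> fst p \<in> dom T \<and> the (T (fst p)) = snd p"
  by (cases p) (auto simp: Map.graph_def)

lemma subspace_graph:
  assumes "linear_operator T"
  shows "complex_vector.subspace (Map.graph T)"
proof (rule complex_vector.subspaceI)
  have subspace: "complex_vector.subspace (dom T)"
    and add: "\<And>f g. f \<in> dom T \<Longrightarrow> g \<in> dom T \<Longrightarrow> the (T (f + g)) = the (T f) + the (T g)"
    and scale: "\<And>c f. f \<in> dom T \<Longrightarrow> the (T (c *\<^sub>C f)) = c *\<^sub>C the (T f)"
    using assms unfolding linear_operator_def by blast+
  show "0 \<in> Map.graph T"
    using complex_vector.subspace_0[OF subspace] scale[of 0 0] by (simp add: mem_graph_iff)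
  show "p + q \<in> Map.graph T" if "p \<in> Map.graph T" "q \<in> Map.graph T" for p q
    using that complex_vector.subspace_add[OF subspace] by (simp add: mem_graph_iff add)
  show "c *\<^sub>C p \<in> Map.graph T" if "p \<in> Map.graph T" for c p
    using that complex_vector.subspace_scale[OF subspace]
    by (simp add: mem_graph_iff scale scaleC_prod_def)
qed

lemma dual_pair_commute:
  assumes "dual_pair A B"
  shows "dual_pair B A"
  using assms unfolding dual_pair_def by (metis cinner_commute)

lemma dual_pair_adj_eq:
  assumes "dual_pair A B" and "densely_defined A" and "g \<in> dom B"
  shows "adj A g = Some (the (B g))"
  using assms unfolding adj_eq_Some_iff[OF assms(2)] dual_pair_def by blast

lemma dual_pair_dom_subset:
  assumes "dual_pair A B" and "densely_defined A"
  shows "dom B \<subseteq> dom (adj A)"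
  using dual_pair_adj_eq[OF assms] by blast

section \<open>The space \<open>\<HH>\<^sub>+\<^sub>A\<close> as the graph of the adjoint\<close>

lemma plus_inner_eq_cinner_graph:
  "plus_inner A f g = cinner (f, the (adj A f)) (g, the (adj A g))"
  by (simp add: plus_inner_def cinner_prod_def)

lemma plus_norm_eq_norm_graph: "plus_norm A f = norm (f, the (adj A f))"
  by (simp add: plus_norm_def plus_inner_eq_cinner_graph norm_eq_sqrt_cinner)

lemma plus_convergent_imp_graph_convergent:
  fixes A :: "'a::complex_inner \<rightharpoonup> 'a"
  assumes "densely_defined A" and "\<And>n. X n \<in> dom (adj A)" and "f \<in> dom (adj A)"
    and "(\<lambda>n. plus_norm A (X n - f)) \<longlonglongrightarrow> 0"
  shows "(\<lambda>n. (X n, the (adj A (X n)))) \<longlonglongrightarrow> (f, the (adj A f))"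
proof (rule LIM_zero_cancel, rule tendsto_norm_zero_cancel)
  have "plus_norm A (X n - f) = norm ((X n, the (adj A (X n))) - (f, the (adj A f)))" for n
    using linear_operator_diff[OF linear_operator_adj[OF assms(1)] assms(2) assms(3)]
    by (simp add: plus_norm_eq_norm_graph)
  then show "(\<lambda>n. norm ((X n, the (adj A (X n))) - (f, the (adj A f)))) \<longlonglongrightarrow> 0"
    using assms(4) by simp
qed

text \<open>On \<open>dom B\<close> the adjoint agrees with \<open>B\<close>, so convergence in \<open>\<HH>\<^sub>+\<^sub>A\<close> of vectors of \<open>dom B\<close> is
  convergence in the graph of \<open>B\<close>, which is closed.\<close>

lemma plus_closed_subspace_dom:
  fixes A B :: "'a::complex_inner \<rightharpoonup> 'a"
  assumes "densely_defined A" and "linear_operator B" and "closed_operator B" and "dual_pair A B"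
  shows "plus_closed_subspace A (dom B)"
  unfolding plus_closed_subspace_def
proof (intro conjI allI ballI impI)
  note dom_subset = dual_pair_dom_subset[OF assms(4,1)]
  note adj_eq = dual_pair_adj_eq[OF assms(4,1)]
  show "dom B \<subseteq> dom (adj A)"
    by (rule dom_subset)
  show "complex_vector.subspace (dom B)"
    using assms(2) by (simp add: linear_operator_def)
  fix X f
  assume "f \<in> dom (adj A)" "\<forall>n. X n \<in> dom B" "(\<lambda>n. plus_norm A (X n - f)) \<longlonglongrightarrow> 0"
  then have lim: "(\<lambda>n. (X n, the (adj A (X n)))) \<longlonglongrightarrow> (f, the (adj A f))"
    using dom_subset by (intro plus_convergent_imp_graph_convergent[OF assms(1)]) auto
  have "(X n, the (adj A (X n))) \<in> Map.graph B" for n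
    using \<open>\<forall>n. X n \<in> dom B\<close> adj_eq[of "X n"] by (simp add: mem_graph_iff)
  then have "(f, the (adj A f)) \<in> Map.graph B"
    using closed_sequentially[OF _ _ lim] assms(3) unfolding closed_operator_def by blast
  then show "f \<in> dom B"
    by (simp add: mem_graph_iff)
qed

lemma mem_kernel_iff:
  "f \<in> op_ker (op_add Some (adj B \<circ>\<^sub>m adj A)) \<longleftrightarrow>
    f \<in> dom (adj A) \<and> adj B (the (adj A f)) = Some (- f)"
  for f :: "'a::complex_inner"
proof -
  have neg: "f + h = 0 \<longleftrightarrow> h = - f" for h
    by (metis add.commute eq_neg_iff_add_eq_0)
  show ?thesis
    by (auto simp: op_ker_def op_add_def map_comp_def dom_def neg split: option.splits)
qed

text \<open>Orthogonality of \<open>f\<close> to \<open>u\<close> in \<open>\<HH>\<^sub>+\<^sub>A\<close> reads \<open>(B u, A\<^sup>* f) = (u, - f)\<close>, so orthogonality to all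
  of \<open>dom B\<close> is the defining condition of \<open>B\<^sup>* (A\<^sup>* f) = - f\<close>.\<close>

lemma kernel_eq_plus_complement:
  fixes A B :: "'a::complex_inner \<rightharpoonup> 'a"
  assumes "densely_defined A" and "densely_defined B" and "dual_pair A B"
  shows "op_ker (op_add Some (adj B \<circ>\<^sub>m adj A)) =
    {f \<in> dom (adj A). \<forall>u\<in>dom B. plus_inner A u f = 0}"
proof (rule set_eqI)
  fix f
  have "plus_inner A u f = 0 \<longleftrightarrow> cinner (the (B u)) (the (adj A f)) = cinner u (- f)"
    if "u \<in> dom B" for u
    using dual_pair_adj_eq[OF assms(3,1) that]
    by (auto simp: plus_inner_def cinner_minus_right eq_neg_iff_add_eq_0 add.commute)
  then show "f \<in> op_ker (op_add Some (adj B \<circ>\<^sub>m adj A)) \<longleftrightarrow>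
      f \<in> {f \<in> dom (adj A). \<forall>u\<in>dom B. plus_inner A u f = 0}"
    by (simp add: mem_kernel_iff adj_eq_Some_iff[OF assms(2)])
qed

lemma plus_closed_subspace_complement:
  fixes A :: "'a::complex_inner \<rightharpoonup> 'a"
  assumes "densely_defined A"
  shows "plus_closed_subspace A {f \<in> dom (adj A). \<forall>u\<in>M. plus_inner A u f = 0}"
    (is "plus_closed_subspace A ?N")
  unfolding plus_closed_subspace_def
proof (intro conjI allI ballI impI)
  have subspace: "complex_vector.subspace (dom (adj A))"
    and add: "\<And>f g. f \<in> dom (adj A) \<Longrightarrow> g \<in> dom (adj A) \<Longrightarrow>
      the (adj A (f + g)) = the (adj A f) + the (adj A g)"
    and scale: "\<And>c f. f \<in> dom (adj A) \<Longrightarrow> the (adj A (c *\<^sub>C f)) = c *\<^sub>C the (adj A f)"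
    using linear_operator_adj[OF assms] unfolding linear_operator_def by blast+
  have zero: "0 \<in> dom (adj A)"
    by (rule complex_vector.subspace_0[OF subspace])
  show "?N \<subseteq> dom (adj A)"
    by blast
  show "complex_vector.subspace ?N"
  proof (rule complex_vector.subspaceI)
    show "0 \<in> ?N"
      using zero scale[OF zero, of 0] by (simp add: plus_inner_def cinner_zero_right)
    show "f + g \<in> ?N" if "f \<in> ?N" "g \<in> ?N" for f g
    proof -
      have "plus_inner A u (f + g) = plus_inner A u f + plus_inner A u g" for u
        using that add[of f g] by (simp add: plus_inner_def cinner_add_right)
      then show ?thesis
        using that complex_vector.subspace_add[OF subspace] by simp
    qed
    show "c *\<^sub>C f \<in> ?N" if "f \<in> ?N" for c f
    proof -
      have "plus_inner A u (c *\<^sub>C f) = cnj c * plus_inner A u f" for u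
        using that scale[of f c] by (simp add: plus_inner_def cinner_scaleC_right algebra_simps)
      then show ?thesis
        using that complex_vector.subspace_scale[OF subspace] by simp
    qed
  qed
  fix X f
  assume f: "f \<in> dom (adj A)" and X: "\<forall>n. X n \<in> ?N"
    and conv: "(\<lambda>n. plus_norm A (X n - f)) \<longlonglongrightarrow> 0"
  then have lim: "(\<lambda>n. (X n, the (adj A (X n)))) \<longlonglongrightarrow> (f, the (adj A f))"
    by (intro plus_convergent_imp_graph_convergent[OF assms]) auto
  have "plus_inner A u f = 0" if "u \<in> M" for u
  proof -
    have "(\<lambda>n. plus_inner A u (X n)) \<longlonglongrightarrow> plus_inner A u f"
      unfolding plus_inner_eq_cinner_graph by (rule tendsto_cinner_right[OF lim])
    moreover have "plus_inner A u (X n) = 0" for n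
      using X that by blast
    ultimately show ?thesis
      by (simp add: LIMSEQ_const_iff)
  qed
  with f show "f \<in> ?N"
    by blast
qed

section \<open>The orthogonal decomposition\<close>

lemma dom_adj_decomposition:
  fixes A B :: "'a::chilbert_space \<rightharpoonup> 'a"
  assumes "densely_defined A" and "linear_operator B" and "densely_defined B"
    and "closed_operator B" and "dual_pair A B"
  shows "is_orth_sum A (dom (adj A)) (dom B) (op_ker (op_add Some (adj B \<circ>\<^sub>m adj A)))"
proof -
  let ?N = "{f \<in> dom (adj A). \<forall>u\<in>dom B. plus_inner A u f = 0}"
  note dom_subset = dual_pair_dom_subset[OF assms(5,1)]
  note adj_eq = dual_pair_adj_eq[OF assms(5,1)]
  have adj_linear: "linear_operator (adj A)"
    by (rule linear_operator_adj[OF assms(1)])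
  have sum: "\<exists>u g. f = u + g \<and> u \<in> dom B \<and> g \<in> ?N" if f: "f \<in> dom (adj A)" for f
  proof -
    obtain p where "p \<in> Map.graph B"
      and orth: "\<And>z. z \<in> Map.graph B \<Longrightarrow> cinner z ((f, the (adj A f)) - p) = 0"
      using exists_orthogonal_projection[of "Map.graph B"] subspace_graph[OF assms(2)] assms(4)
      unfolding closed_operator_def by blast
    then obtain u where u: "u \<in> dom B" and p: "p = (u, the (B u))"
      by (metis mem_graph_iff prod.collapse)
    have u': "u \<in> dom (adj A)"
      using u dom_subset by blast
    \<comment> \<open>Because \<open>B \<subseteq> A\<^sup>*\<close>, the remainder is again a point of the graph of \<open>A\<^sup>*\<close>, so its
      orthogonality to the graph of \<open>B\<close> is orthogonality in \<open>\<HH>\<^sub>+\<^sub>A\<close>.\<close>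
    have remainder: "(f, the (adj A f)) - p = (f - u, the (adj A (f - u)))"
      using linear_operator_diff(2)[OF adj_linear f u'] adj_eq[OF u] p by simp
    have "plus_inner A v (f - u) = 0" if "v \<in> dom B" for v
    proof -
      have "(v, the (adj A v)) \<in> Map.graph B"
        using that adj_eq[OF that] by (simp add: mem_graph_iff)
      then show ?thesis
        using orth remainder by (simp add: plus_inner_eq_cinner_graph)
    qed
    then have "f - u \<in> ?N"
      using linear_operator_diff(1)[OF adj_linear f u'] by blast
    then show ?thesis
      using u by (intro exI[of _ u] exI[of _ "f - u"]) simp
  qed
  have "dom (adj A) = {f + g | f g. f \<in> dom B \<and> g \<in> ?N}"
  proof
    show "dom (adj A) \<subseteq> {f + g | f g. f \<in> dom B \<and> g \<in> ?N}"
      using sum by blast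
    show "{f + g | f g. f \<in> dom B \<and> g \<in> ?N} \<subseteq> dom (adj A)"
      using dom_subset adj_linear complex_vector.subspace_add unfolding linear_operator_def by blast
  qed
  then show ?thesis
    unfolding is_orth_sum_def kernel_eq_plus_complement[OF assms(1,3,5)]
    using plus_closed_subspace_dom[OF assms(1,2,4,5)] plus_closed_subspace_complement[OF assms(1)]
    by blast
qed

text \<open>If \<open>A\<^sup>* = B\<close>, an element of the kernel lies in both orthogonal summands, hence is orthogonal to
  itself. If the kernel is trivial, \<open>A\<^sup>*\<close> has the domain of its restriction \<open>B\<close>.\<close>

lemma adj_eq_iff_kernel_trivial:
  fixes A B :: "'a::chilbert_space \<rightharpoonup> 'a"
  assumes "densely_defined A" and "linear_operator B" and "densely_defined B"
    and "closed_operator B" and "dual_pair A B"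
  shows "adj A = B \<longleftrightarrow> op_ker (op_add Some (adj B \<circ>\<^sub>m adj A)) = {0}" (is "_ \<longleftrightarrow> ?N = {0}")
proof
  have decomposition: "dom (adj A) = {f + g | f g. f \<in> dom B \<and> g \<in> ?N}"
    and closed: "plus_closed_subspace A ?N"
    and orth: "\<forall>f\<in>dom B. \<forall>g\<in>?N. plus_inner A f g = 0"
    using dom_adj_decomposition[OF assms] unfolding is_orth_sum_def by blast+
  show "?N = {0}" if "adj A = B"
  proof -
    have "g = 0" if "g \<in> ?N" for g
    proof -
      have "g \<in> dom B"
        using that closed \<open>adj A = B\<close> unfolding plus_closed_subspace_def by blast
      then have "cinner (g, the (adj A g)) (g, the (adj A g)) = 0"
        using orth that by (simp add: plus_inner_eq_cinner_graph)
      then show ?thesis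
        by (simp add: cinner_eq_zero_iff prod_eq_iff)
    qed
    moreover have "0 \<in> ?N"
      using closed complex_vector.subspace_0 unfolding plus_closed_subspace_def by blast
    ultimately show ?thesis
      by blast
  qed
  show "adj A = B" if "?N = {0}"
  proof
    fix f
    have "dom (adj A) = dom B"
      unfolding decomposition that by simp
    then show "adj A f = B f"
      using dual_pair_adj_eq[OF assms(5,1), of f] by (cases "f \<in> dom B") (auto simp: domIff)
  qed
qed

text \<open>The map \<open>f \<mapsto> A\<^sup>* f\<close> sends \<open>ker (I + B\<^sup>* A\<^sup>*)\<close> injectively into \<open>ker (I + A\<^sup>* B\<^sup>*)\<close>, because \<open>f\<close> is
  recovered as \<open>- B\<^sup>* (A\<^sup>* f)\<close>.\<close>

lemma kernel_trivial_if_swapped_kernel_trivial: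
  fixes A B :: "'a::complex_inner \<rightharpoonup> 'a"
  assumes "densely_defined A" and "densely_defined B"
    and trivial: "op_ker (op_add Some (adj A \<circ>\<^sub>m adj B)) = {0}"
  shows "op_ker (op_add Some (adj B \<circ>\<^sub>m adj A)) = {0}"
proof -
  have zero: "adj T 0 = Some 0" if "densely_defined T" for T :: "'a \<rightharpoonup> 'a"
    by (simp add: adj_eq_Some_iff[OF that] cinner_zero_right)
  have neg: "adj A (- f) = Some (- h)" if "adj A f = Some h" for f h
    using that by (simp add: adj_eq_Some_iff[OF assms(1)] cinner_minus_right)
  have "f = 0" if "f \<in> op_ker (op_add Some (adj B \<circ>\<^sub>m adj A))" for f
  proof -
    obtain h where h: "adj A f = Some h" "adj B h = Some (- f)"
      using \<open>f \<in> _\<close> unfolding mem_kernel_iff by auto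
    then have "h \<in> op_ker (op_add Some (adj A \<circ>\<^sub>m adj B))"
      using neg unfolding mem_kernel_iff by auto
    then have "h = 0"
      using trivial by blast
    then show ?thesis
      using h(2) zero[OF assms(2)] by simp
  qed
  moreover have "0 \<in> op_ker (op_add Some (adj B \<circ>\<^sub>m adj A))"
    using zero[OF assms(1)] zero[OF assms(2)] unfolding mem_kernel_iff by auto
  ultimately show ?thesis
    by blast
qed


theorem proposition2p3:
  fixes A B :: "'a::chilbert_space \<rightharpoonup> 'a"
  assumes "linear_operator A" and "densely_defined A" and "closed_operator A"
    and "linear_operator B" and "densely_defined B" and "closed_operator B"
    and "dual_pair A B"
  shows "is_orth_sum A (dom (adj A)) (dom B) (op_ker (op_add Some (adj B \<circ>\<^sub>m adj A))) \<and>
         is_orth_sum B (dom (adj B)) (dom A) (op_ker (op_add Some (adj A \<circ>\<^sub>m adj B))) \<and>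
         (adj A = B \<longleftrightarrow> op_ker (op_add Some (adj B \<circ>\<^sub>m adj A)) = {0}) \<and>
         (adj A = B \<longleftrightarrow> A = adj B) \<and>
         (op_ker (op_add Some (adj B \<circ>\<^sub>m adj A)) = {0} \<longleftrightarrow>
          op_ker (op_add Some (adj A \<circ>\<^sub>m adj B)) = {0})"
proof -
  let ?N = "op_ker (op_add Some (adj B \<circ>\<^sub>m adj A))"
  let ?N' = "op_ker (op_add Some (adj A \<circ>\<^sub>m adj B))"
  have dual': "dual_pair B A"
    by (rule dual_pair_commute[OF \<open>dual_pair A B\<close>])
  have kernels: "?N = {0} \<longleftrightarrow> ?N' = {0}"
    using kernel_trivial_if_swapped_kernel_trivial[OF assms(2,5)]
      kernel_trivial_if_swapped_kernel_trivial[OF assms(5,2)] by (rule iffI[rotated])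
  have adj_A: "adj A = B \<longleftrightarrow> ?N = {0}"
    by (rule adj_eq_iff_kernel_trivial[OF assms(2,4,5,6,7)])
  have adj_B: "adj B = A \<longleftrightarrow> ?N' = {0}"
    by (rule adj_eq_iff_kernel_trivial[OF assms(5,1,2,3) dual'])
  show ?thesis
  proof (intro conjI)
    show "is_orth_sum A (dom (adj A)) (dom B) ?N"
      by (rule dom_adj_decomposition[OF assms(2,4,5,6,7)])
    show "is_orth_sum B (dom (adj B)) (dom A) ?N'"
      by (rule dom_adj_decomposition[OF assms(5,1,2,3) dual'])
    show "adj A = B \<longleftrightarrow> ?N = {0}"
      by (rule adj_A)
    show "adj A = B \<longleftrightarrow> A = adj B"
      unfolding adj_A kernels adj_B[symmetric] by (rule eq_commute)
    show "?N = {0} \<longleftrightarrow> ?N' = {0}"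
      by (rule kernels)
  qed
qed

end
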